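(* Let $c_0\ge 0$ and $\hat\varphi\in\mathcal N_{c_0}(\mathbb R^+)$. Set $a_n := \hat\varphi^{(n)}(0)$ for every $n\in\mathbb N$ and $\varphi := \mathcal L^0\hat\varphi$. Then for any $c_1>c_0$ there exist $L,M>0$ such that $$\bigl|\varphi(z)-a_0z^{-1}-a_1z^{-2}-\cdots-a_{N-1}z^{-N}\bigr|\le L\,M^N\,N!\,|z|^{-N-1}\qquad\text{for all } z\in\Pi_{c_1},\ N\in\mathbb N.$$
   Context: $\mathbb N=\{0,1,2,\dots\}$. For $\delta>0$, $S_\delta=\{\zeta\in\mathbb C\mid \mathrm{dist}(\zeta,\mathbb R^+)<\delta\}$ where $\mathbb R^+=[0,+\infty)$. For $c_0\in\mathbb R$, $\mathcal N_{c_0}(\mathbb R^+)$ is the set of all convergent power series $\hat\varphi(\zeta)\in\mathbb C\{\zeta\}$ defining a holomorphic function near $0$ which, for some $\delta>0$ and some $A>0$, extends analytically to $S_\delta$ with $|\hat\varphi(\zeta)|\le A\,e^{c_0|\zeta|}$ for all $\zeta\in S_\delta$ (the extension is still denoted $\hat\varphi$). For $c\in\mathbb R$, $\Pi_c=\{z\in\mathbb C\mid \mathrm{Re}\,z>c\}$. The Laplace transform is $(\mathcal L^0\hat\varphi)(z)=\int_0^{+\infty}e^{-z\zeta}\hat\varphi(\zeta)\,d\zeta$, holomorphic in $\Pi_{c_0}$ for $\hat\varphi\in\mathcal N_{c_0}(\mathbb R^+)$. *)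

theory Defs
  imports "HOL-Complex_Analysis.Complex_Analysis"
begin

definition Rplus :: "complex set" where
  "Rplus = complex_of_real ` {0..}"

definition halfstrip :: "real \<Rightarrow> complex set" where
  "halfstrip \<delta> = {\<zeta>. infdist \<zeta> Rplus < \<delta>}"

definition halfplane :: "real \<Rightarrow> complex set" where
  "halfplane c = {z. Re z > c}"

text \<open>Positivity of the radius of convergence of \<open>F\<close> is part of \<^const>\<open>has_fps_expansion\<close>.\<close>

definition extension_on_halfstrip :: "complex fps \<Rightarrow> real \<Rightarrow> (complex \<Rightarrow> complex) \<Rightarrow> bool" where
  "extension_on_halfstrip F \<delta> f \<longleftrightarrow> f holomorphic_on halfstrip \<delta> \<and> f has_fps_expansion F"

definition nice_series :: "real \<Rightarrow> complex fps set" where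
  "nice_series c0 = {F. \<exists>\<delta>>0. \<exists>A>0. \<exists>f. extension_on_halfstrip F \<delta> f \<and>
     (\<forall>\<zeta>\<in>halfstrip \<delta>. norm (f \<zeta>) \<le> A * exp (c0 * norm \<zeta>))}"

text \<open>The extension of \<open>F\<close>, as a function. The choice of \<open>f\<close> and \<open>\<delta>\<close> does not matter near
  \<open>\<real>\<^sup>+\<close>, see \<open>continuation_eq\<close> below; far from \<open>\<real>\<^sup>+\<close> the values are meaningless.\<close>

definition continuation :: "complex fps \<Rightarrow> complex \<Rightarrow> complex" where
  "continuation F = (SOME f. \<exists>\<delta>>0. extension_on_halfstrip F \<delta> f)"

definition laplace :: "complex fps \<Rightarrow> complex \<Rightarrow> complex" where
  "laplace F z = (CLBINT t:{0..}. exp (- z * complex_of_real t) * continuation F (complex_of_real t))"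

lemma halfstrip_eq: "halfstrip \<delta> = (\<Union>x\<in>Rplus. \<Union>y\<in>ball 0 \<delta>. {x + y})"
proof -
  have ne: "Rplus \<noteq> {}" by (auto simp: Rplus_def)
  have "\<zeta> \<in> halfstrip \<delta> \<longleftrightarrow> (\<exists>x\<in>Rplus. dist \<zeta> x < \<delta>)" for \<zeta>
    using ne by (auto simp: halfstrip_def infdist_def cINF_less_iff)
  moreover have "(\<exists>x\<in>Rplus. dist \<zeta> x < \<delta>) \<longleftrightarrow> (\<exists>x\<in>Rplus. \<exists>y\<in>ball 0 \<delta>. \<zeta> = x + y)" for \<zeta>
  proof (intro bex_cong refl)
    fix x
    show "dist \<zeta> x < \<delta> \<longleftrightarrow> (\<exists>y\<in>ball 0 \<delta>. \<zeta> = x + y)"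
      by (auto simp: dist_norm norm_minus_commute intro!: bexI[of _ "\<zeta> - x"])
  qed
  ultimately show ?thesis by auto
qed

lemma convex_halfstrip: "convex (halfstrip \<delta>)"
proof -
  have "convex Rplus"
    unfolding Rplus_def
    by (rule convex_linear_image) (rule bounded_linear.linear[OF bounded_linear_of_real], simp)
  then show ?thesis
    unfolding halfstrip_eq by (rule convex_sums) simp
qed

lemma open_halfstrip: "open (halfstrip \<delta>)"
  unfolding halfstrip_def by (intro open_Collect_less continuous_intros)

lemma Rplus_subset_halfstrip: "\<delta> > 0 \<Longrightarrow> Rplus \<subseteq> halfstrip \<delta>"
  by (auto simp: halfstrip_def)

lemma halfstrip_mono: "\<delta> \<le> \<delta>' \<Longrightarrow> halfstrip \<delta> \<subseteq> halfstrip \<delta>'"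
  by (auto simp: halfstrip_def)

lemma extension_unique:
  assumes "extension_on_halfstrip F \<delta> f" "extension_on_halfstrip F \<delta>' g"
    and "\<delta> > 0" "\<delta>' > 0" and z: "z \<in> halfstrip (min \<delta> \<delta>')"
  shows "f z = g z"
proof -
  let ?H = "halfstrip (min \<delta> \<delta>')"
  have "eventually (\<lambda>w. f w = g w) (nhds 0)"
    using assms(1,2) unfolding extension_on_halfstrip_def has_fps_expansion_def
    by (auto elim: eventually_elim2)
  then obtain U where U: "open U" "0 \<in> U" "\<And>w. w \<in> U \<Longrightarrow> f w = g w"
    by (auto simp: eventually_nhds)
  have 0: "0 \<in> ?H"
    using Rplus_subset_halfstrip[of "min \<delta> \<delta>'"] assms(3,4) by (auto simp: Rplus_def)
  show ?thesis
  proof (rule analytic_continuation_open[of "U \<inter> ?H" ?H f g])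
    show "f holomorphic_on ?H" "g holomorphic_on ?H"
      using assms(1,2) halfstrip_mono[of "min \<delta> \<delta>'" \<delta>] halfstrip_mono[of "min \<delta> \<delta>'" \<delta>']
      by (auto simp: extension_on_halfstrip_def intro: holomorphic_on_subset)
  qed (use U 0 z in \<open>auto simp: open_halfstrip convex_connected convex_halfstrip\<close>)
qed

lemma continuation_eq:
  assumes "extension_on_halfstrip F \<delta> f" "\<delta> > 0"
  shows "\<exists>\<delta>'>0. extension_on_halfstrip F \<delta>' (continuation F) \<and>
           (\<forall>z\<in>halfstrip \<delta>'. continuation F z = f z)"
proof -
  have "\<exists>\<delta>'>0. extension_on_halfstrip F \<delta>' (continuation F)"
    unfolding continuation_def using assms by (intro someI_ex[of "\<lambda>f. \<exists>\<delta>>0. extension_on_halfstrip F \<delta> f"]) blast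
  then obtain d where d: "d > 0" "extension_on_halfstrip F d (continuation F)" by blast
  show ?thesis
  proof (intro exI[of _ "min \<delta> d"] conjI ballI)
    show "min \<delta> d > 0" using assms d by simp
    show "extension_on_halfstrip F (min \<delta> d) (continuation F)"
      using d(2) holomorphic_on_subset[OF _ halfstrip_mono[of "min \<delta> d" d]]
      by (simp add: extension_on_halfstrip_def)
    show "continuation F z = f z" if "z \<in> halfstrip (min \<delta> d)" for z
      using extension_unique[OF assms(1) d(2) assms(2) d(1) that] by simp
  qed
qed

end

theory Submission
  imports Defs
begin

text \<open>Cauchy's inequality on discs of fixed radius \<open>r\<close> centred on \<open>\<real>\<^sup>+\<close> bounds the \<open>n\<close>-th derivative
  of \<open>\<phi>\<close> at \<open>t\<close> by \<open>n! C r\<^sup>-\<^sup>n exp (c\<^sub>0 t)\<close>. Integrating by parts \<open>N\<close> times in the Laplace integral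
  yields the partial sum of the expansion, with remainder \<open>z\<^sup>-\<^sup>N\<close> times the Laplace transform of the
  \<open>N\<close>-th derivative. Bounding this directly loses a factor \<open>\<bar>z\<bar>\<close>, so one integrates by parts once more
  and estimates the extra term \<open>a\<^sub>N z\<^sup>-\<^sup>N\<^sup>-\<^sup>1\<close> separately.\<close>

section \<open>Laplace integrals over the half-line of functions of exponential growth\<close>

lemma exp_minus_integrable_atLeast:
  fixes k :: real
  assumes "k > 0"
  shows "set_integrable lborel {0..} (\<lambda>t. exp (- k * t))"
    and "(LBINT t:{0..}. exp (- k * t)) = 1 / k"
proof -
  \<comment> \<open>Gauge integrability is absolute because the integrand is nonnegative;
    \<open>integrable_completion\<close> then passes from Lebesgue measure to
    \<open>lborel\<close>.\<close>
  have "(\<lambda>t. exp (- k * t)) absolutely_integrable_on {0..}"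
    by (intro nonnegative_absolutely_integrable_1 integrable_on_exp_minus_to_infinity assms) auto
  then show *: "set_integrable lborel {0..} (\<lambda>t. exp (- k * t))"
    unfolding set_integrable_def by (subst (asm) integrable_completion) auto
  show "(LBINT t:{0..}. exp (- k * t)) = 1 / k"
    using set_borel_integral_eq_integral(2)[OF *] has_integral_exp_minus_to_infinity[OF assms, of 0]
    by (simp add: integral_unique)
qed

lemma norm_laplace_integrand_le:
  fixes g :: "real \<Rightarrow> complex"
  assumes "norm (g t) \<le> C * exp (c * t)"
  shows "norm (exp (- z * of_real t) * g t) \<le> C * exp (- (Re z - c) * t)"
proof -
  have "norm (exp (- z * of_real t) * g t) = exp (- Re z * t) * norm (g t)"
    by (simp add: norm_mult)
  also have "\<dots> \<le> exp (- Re z * t) * (C * exp (c * t))"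
    using assms by (intro mult_left_mono) auto
  also have "\<dots> = C * exp (- (Re z - c) * t)"
    by (simp add: mult.left_commute flip: exp_add) (simp add: algebra_simps)
  finally show ?thesis .
qed

text \<open>The integrand is dominated by a real exponential of rate \<open>Re z - c > 0\<close>,
  whose integral is known. Continuity of \<open>g\<close> supplies measurability.\<close>

lemma laplace_integral_bound:
  fixes g :: "real \<Rightarrow> complex"
  assumes cont: "continuous_on {0..} g"
    and bound: "\<And>t. t \<ge> 0 \<Longrightarrow> norm (g t) \<le> C * exp (c * t)"
    and z: "Re z > c"
  shows "set_integrable lborel {0..} (\<lambda>t. exp (- z * of_real t) * g t)"
    and "norm (CLBINT t:{0..}. exp (- z * of_real t) * g t) \<le> C / (Re z - c)"
proof -
  let ?h = "\<lambda>t. exp (- z * complex_of_real t) * g t"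
  have k: "Re z - c > 0" using z by simp
  have int: "set_integrable lborel {0..} (\<lambda>t. C * exp (- (Re z - c) * t))"
    using exp_minus_integrable_atLeast(1)[OF k] by (intro set_integrable_mult_right) auto
  have le: "norm (?h t) \<le> C * exp (- (Re z - c) * t)" if "t \<ge> 0" for t
    using norm_laplace_integrand_le bound[OF that] by blast
  have "continuous_on {0..} ?h"
    by (intro continuous_intros cont)
  then have meas: "set_borel_measurable lborel {0..} ?h"
    using set_measurable_continuous_on[of "{0..}" ?h] by (simp add: set_borel_measurable_def)
  show h: "set_integrable lborel {0..} ?h"
  proof (rule set_integrable_bound[OF int meas], intro AE_I2 impI)
    fix t :: real assume "t \<in> {0..}"
    then have "norm (?h t) \<le> C * exp (- (Re z - c) * t)"
      using le by simp
    also have "\<dots> \<le> norm (C * exp (- (Re z - c) * t))"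
      by simp
    finally show "norm (?h t) \<le> norm (C * exp (- (Re z - c) * t))" .
  qed
  have "norm (CLBINT t:{0..}. ?h t) \<le> (LBINT t:{0..}. norm (?h t))"
    by (rule set_integral_norm_bound[OF h])
  also have "\<dots> \<le> (LBINT t:{0..}. C * exp (- (Re z - c) * t))"
    by (intro set_integral_mono set_integrable_norm h int) (use le in auto)
  also have "\<dots> = C / (Re z - c)"
    using exp_minus_integrable_atLeast(2)[OF k] by simp
  finally show "norm (CLBINT t:{0..}. ?h t) \<le> C / (Re z - c)" .
qed

text \<open>The fundamental theorem of calculus is applied to \<open>exp (- z * t) * g t\<close> on
  \<open>{0..b}\<close>, and then \<open>b\<close> tends to infinity. The boundary term at
  \<open>b\<close> vanishes in the limit because \<open>Re z > c\<close>; the growth bounds on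
  \<open>g\<close> and \<open>g'\<close> make both integrals converge separately.\<close>

lemma laplace_integral_by_parts:
  fixes g g' :: "real \<Rightarrow> complex"
  assumes deriv: "\<And>t. t \<ge> 0 \<Longrightarrow> (g has_vector_derivative g' t) (at t)"
    and cont: "continuous_on {0..} g'"
    and bound: "\<And>t. t \<ge> 0 \<Longrightarrow> norm (g t) \<le> C * exp (c * t)"
    and bound': "\<And>t. t \<ge> 0 \<Longrightarrow> norm (g' t) \<le> C' * exp (c * t)"
    and z: "Re z > c"
  shows "z * (CLBINT t:{0..}. exp (- z * of_real t) * g t)
       = g 0 + (CLBINT t:{0..}. exp (- z * of_real t) * g' t)"
proof -
  let ?e = "\<lambda>t. exp (- z * complex_of_real t)"
  let ?F = "\<lambda>t. ?e t * g t" and ?f = "\<lambda>t. ?e t * g' t - z * (?e t * g t)"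
  have contg: "continuous_on {0..} g"
    using deriv by (auto intro!: continuous_at_imp_continuous_on has_vector_derivative_continuous)
  have int: "set_integrable lborel {0..} (\<lambda>t. ?e t * g t)"
    and int': "set_integrable lborel {0..} (\<lambda>t. ?e t * g' t)"
    using laplace_integral_bound(1)[OF contg bound z] laplace_integral_bound(1)[OF cont bound' z] by auto
  have intz: "set_integrable lborel {0..} (\<lambda>t. z * (?e t * g t))"
    using int by (intro set_integrable_mult_right) auto
  have intf: "set_integrable lborel {0..} ?f"
    by (rule set_integral_diff(1)[OF int' intz])
  have FTC: "(CLBINT t:{0..b}. ?f t) = ?F b - g 0" if "b \<ge> 0" for b
  proof -
    have "(?F has_vector_derivative ?f t) (at t within {0..b})" if "0 \<le> t" for t
    proof -
      have "(?e has_vector_derivative - z * ?e t) (at t)"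
        by (rule has_vector_derivative_real_field) (auto intro!: derivative_eq_intros)
      then have "(?F has_vector_derivative ?e t * g' t + - z * ?e t * g t) (at t)"
        using has_vector_derivative_mult deriv[OF that] by blast
      then show ?thesis
        by (simp add: has_vector_derivative_at_within algebra_simps)
    qed
    moreover have "continuous_on {0..b} ?f"
      by (intro continuous_intros continuous_on_subset[OF cont] continuous_on_subset[OF contg]) auto
    ultimately show ?thesis
      using integral_FTC_atLeastAtMost[of 0 b ?F ?f] that by (simp add: set_lebesgue_integral_def)
  qed
  have "(?F \<longlongrightarrow> 0) at_top"
  proof (rule Lim_null_comparison)
    show "\<forall>\<^sub>F t in at_top. norm (?F t) \<le> C * exp (- (Re z - c) * t)"
      using eventually_ge_at_top[of 0] by eventually_elim (rule norm_laplace_integrand_le[OF bound])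
    have "filterlim (\<lambda>t. - (Re z - c) * t) at_bot at_top"
      using z by (intro filterlim_tendsto_neg_mult_at_bot[OF tendsto_const _ filterlim_ident]) auto
    from tendsto_mult_right_zero[OF filterlim_compose[OF exp_at_bot this]]
    show "((\<lambda>t. C * exp (- (Re z - c) * t)) \<longlongrightarrow> 0) at_top" .
  qed
  then have "((\<lambda>t. ?F t - g 0) \<longlongrightarrow> 0 - g 0) at_top"
    by (intro tendsto_intros)
  \<comment> \<open>By \<open>FTC\<close> the truncated integrals give a second limit of the same
    expression; uniqueness of limits identifies the two.\<close>
  moreover have "((\<lambda>b. CLBINT t:{0..b}. ?f t) \<longlongrightarrow> (CLBINT t:{0..}. ?f t)) at_top"
    by (intro tendsto_set_lebesgue_integral_at_top intf) auto
  then have "((\<lambda>b. ?F b - g 0) \<longlongrightarrow> (CLBINT t:{0..}. ?f t)) at_top"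
    by (rule Lim_transform_eventually) (rule eventually_mono[OF eventually_ge_at_top[of 0] FTC])
  ultimately have "(CLBINT t:{0..}. ?f t) = - g 0"
    using tendsto_unique[OF trivial_limit_at_top_linorder] by fastforce
  moreover have "(CLBINT t:{0..}. ?f t) = (CLBINT t:{0..}. ?e t * g' t) - z * (CLBINT t:{0..}. ?e t * g t)"
    using set_integral_diff(2)[OF int' intz] by simp
  ultimately show ?thesis
    by (simp add: algebra_simps)
qed

text \<open>Each induction step integrates the remainder by parts once. The constant
  \<open>C n\<close> may vary with \<open>n\<close>, but the rate \<open>c\<close> may not, so all
  the integrals converge on one half-plane. Since \<open>c\<close> may be negative,
  \<open>z \<noteq> 0\<close> is a separate assumption.\<close>

lemma laplace_expansion:
  fixes g :: "nat \<Rightarrow> real \<Rightarrow> complex"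
  assumes deriv: "\<And>n t. t \<ge> 0 \<Longrightarrow> (g n has_vector_derivative g (Suc n) t) (at t)"
    and bound: "\<And>n t. t \<ge> 0 \<Longrightarrow> norm (g n t) \<le> C n * exp (c * t)"
    and z: "Re z > c" "z \<noteq> 0"
  shows "(CLBINT t:{0..}. exp (- z * of_real t) * g 0 t)
       = (\<Sum>n<N. g n 0 * z powi (- int n - 1))
         + z powi (- int N) * (CLBINT t:{0..}. exp (- z * of_real t) * g N t)"
proof (induction N)
  case (Suc N)
  let ?I = "\<lambda>n. CLBINT t:{0..}. exp (- z * of_real t) * g n t"
  have cont: "continuous_on {0..} (g n)" for n
    using deriv by (auto intro!: continuous_at_imp_continuous_on has_vector_derivative_continuous)
  have "z * ?I N = g N 0 + ?I (Suc N)"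
    using laplace_integral_by_parts[OF deriv cont bound bound z(1)] .
  then have "?I N = (g N 0 + ?I (Suc N)) / z"
    using z(2) by (simp add: field_simps)
  moreover have "z powi (- int N - 1) = z powi (- int N) / z"
    using z(2) by (simp add: power_int_diff)
  moreover have "- int (Suc N) = - int N - 1"
    by simp
  ultimately show ?case
    using Suc.IH by (simp only: sum.lessThan_Suc) (simp add: algebra_simps add_divide_distrib)
qed simp

section \<open>Cauchy estimates for the derivatives along the positive real axis\<close>

lemma cball_subset_halfstrip:
  assumes "t \<ge> 0" "r < \<delta>"
  shows "cball (complex_of_real t) r \<subseteq> halfstrip \<delta>"
proof
  fix x assume "x \<in> cball (complex_of_real t) r"
  moreover have "infdist x Rplus \<le> dist x (complex_of_real t)"
    using assms by (intro infdist_le) (auto simp: Rplus_def)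
  ultimately show "x \<in> halfstrip \<delta>"
    using assms by (auto simp: halfstrip_def dist_commute)
qed

text \<open>On the circle of radius \<open>r\<close> about \<open>t\<close> the modulus is at most
  \<open>t + r\<close>, so the growth bound loses only the factor \<open>exp (c * r)\<close>, which
  is independent of \<open>t\<close> and \<open>n\<close>.\<close>

lemma higher_deriv_bound_on_Rplus:
  assumes hol: "f holomorphic_on halfstrip \<delta>"
    and bound: "\<And>\<zeta>. \<zeta> \<in> halfstrip \<delta> \<Longrightarrow> norm (f \<zeta>) \<le> A * exp (c * norm \<zeta>)"
    and "c \<ge> 0" "A \<ge> 0" "0 < r" "r < \<delta>" "t \<ge> 0"
  shows "norm ((deriv ^^ n) f (of_real t)) \<le> fact n * (A * exp (c * r)) / r ^ n * exp (c * t)"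
proof -
  note sub = cball_subset_halfstrip[OF \<open>t \<ge> 0\<close> \<open>r < \<delta>\<close>]
  have "norm ((deriv ^^ n) f (of_real t)) \<le> fact n * (A * exp (c * (t + r))) / r ^ n"
  proof (rule Cauchy_inequality)
    show "f holomorphic_on ball (of_real t) r" "continuous_on (cball (of_real t) r) f"
      using holomorphic_on_subset[OF hol sub] ball_subset_cball
      by (auto intro: holomorphic_on_subset holomorphic_on_imp_continuous_on)
    fix x :: complex assume x: "norm (of_real t - x) = r"
    have "norm x \<le> t + r"
      using norm_triangle_ineq4[of "of_real t" "of_real t - x"] x \<open>t \<ge> 0\<close> by simp
    \<comment> \<open>Here \<open>c \<ge> 0\<close> makes the exponential monotone in the
      modulus.\<close>
    then have "A * exp (c * norm x) \<le> A * exp (c * (t + r))"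
      using assms by (auto intro!: mult_left_mono)
    moreover have "x \<in> halfstrip \<delta>"
      using x sub by (auto simp: dist_norm)
    ultimately show "norm (f x) \<le> A * exp (c * (t + r))"
      using bound by fastforce
  qed fact
  then show ?thesis
    by (simp add: distrib_left exp_add mult_ac)
qed

text \<open>The half-strip is an open neighbourhood of \<open>Rplus\<close>, so the derivative is
  two-sided even at \<open>t = 0\<close>.\<close>

lemma higher_deriv_has_vector_derivative_on_Rplus:
  assumes "f holomorphic_on halfstrip \<delta>" "\<delta> > 0" "t \<ge> 0"
  shows "((\<lambda>t. (deriv ^^ n) f (of_real t)) has_vector_derivative (deriv ^^ Suc n) f (of_real t)) (at t)"
proof -
  have "of_real t \<in> halfstrip \<delta>"
    using Rplus_subset_halfstrip[OF \<open>\<delta> > 0\<close>] \<open>t \<ge> 0\<close> by (auto simp: Rplus_def)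
  moreover have "(deriv ^^ n) f holomorphic_on halfstrip \<delta>"
    by (intro holomorphic_higher_deriv assms open_halfstrip)
  ultimately have "((deriv ^^ n) f has_field_derivative (deriv ^^ Suc n) f (of_real t)) (at (of_real t))"
    using holomorphic_derivI[OF _ open_halfstrip] by simp
  then show ?thesis
    by (rule has_vector_derivative_real_field)
qed

text \<open>The growth bound is known for some extension \<open>f\<close> only. It passes to
  \<open>continuation F\<close> on a possibly thinner strip, where the two functions agree.\<close>

lemma nice_series_continuation:
  assumes "F \<in> nice_series c"
  obtains \<delta> A where "\<delta> > 0" "A > 0" "continuation F holomorphic_on halfstrip \<delta>"
    "\<And>\<zeta>. \<zeta> \<in> halfstrip \<delta> \<Longrightarrow> norm (continuation F \<zeta>) \<le> A * exp (c * norm \<zeta>)"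
proof -
  obtain \<delta> A f where f: "\<delta> > 0" "A > 0" "extension_on_halfstrip F \<delta> f"
    "\<And>\<zeta>. \<zeta> \<in> halfstrip \<delta> \<Longrightarrow> norm (f \<zeta>) \<le> A * exp (c * norm \<zeta>)"
    using assms unfolding nice_series_def by blast
  obtain \<delta>' where "\<delta>' > 0" "extension_on_halfstrip F \<delta>' (continuation F)"
    "\<And>z. z \<in> halfstrip \<delta>' \<Longrightarrow> continuation F z = f z"
    using continuation_eq[OF f(3,1)] by blast
  moreover have "halfstrip (min \<delta> \<delta>') \<subseteq> halfstrip \<delta>" "halfstrip (min \<delta> \<delta>') \<subseteq> halfstrip \<delta>'"
    by (auto intro!: halfstrip_mono)
  ultimately show thesis
    using f by (intro that[of "min \<delta> \<delta>'" A])
      (auto simp: extension_on_halfstrip_def subset_iff intro: holomorphic_on_subset)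
qed

theorem theorem7p2:
  fixes c0 c1 :: real and F :: "complex fps"
  assumes "c0 \<ge> 0" and "F \<in> nice_series c0" and "c1 > c0"
  shows "\<exists>L>0. \<exists>M>0. \<forall>z\<in>halfplane c1. \<forall>N::nat.
           norm (laplace F z - (\<Sum>n<N. (deriv ^^ n) (continuation F) 0 * z powi (- int n - 1)))
             \<le> L * M ^ N * fact N * norm z powi (- int N - 1)"
proof -
  obtain \<delta> A where "\<delta> > 0" "A > 0" and hol: "continuation F holomorphic_on halfstrip \<delta>"
    and bound: "\<And>\<zeta>. \<zeta> \<in> halfstrip \<delta> \<Longrightarrow> norm (continuation F \<zeta>) \<le> A * exp (c0 * norm \<zeta>)"
    using nice_series_continuation[OF assms(2)] by blast
  define r where "r = \<delta> / 2"
  have r: "0 < r" "r < \<delta>" using \<open>\<delta> > 0\<close> by (auto simp: r_def)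
  define B where "B = A * exp (c0 * r)"
  \<comment> \<open>A lower bound for \<open>Re z - c0\<close> on the half-plane, which makes the
    estimates uniform in \<open>z\<close>.\<close>
  define k where "k = c1 - c0"
  have "B > 0" "k > 0" using \<open>A > 0\<close> assms(3) by (auto simp: B_def k_def)
  define g where "g = (\<lambda>n t. (deriv ^^ n) (continuation F) (complex_of_real t))"
  have deriv: "(g n has_vector_derivative g (Suc n) t) (at t)" if "t \<ge> 0" for n t
    unfolding g_def using higher_deriv_has_vector_derivative_on_Rplus[OF hol \<open>\<delta> > 0\<close> that] .
  have gbound: "norm (g n t) \<le> fact n * B / r ^ n * exp (c0 * t)" if "t \<ge> 0" for n t
    using higher_deriv_bound_on_Rplus[OF hol bound assms(1) _ r that] \<open>A > 0\<close>
    by (simp add: g_def B_def)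
  have cont: "continuous_on {0..} (g n)" for n
    using deriv by (auto intro!: continuous_at_imp_continuous_on has_vector_derivative_continuous)
  \<comment> \<open>In \<open>L\<close> the summand \<open>1\<close> accounts for the term
    \<open>g N 0\<close> and \<open>1 / (r * k)\<close> for the integral. The \<open>2\<close> in
    \<open>M\<close> absorbs the factor \<open>N + 1\<close> of \<open>fact (Suc N)\<close>.\<close>
  define L where "L = B * (1 + 1 / (r * k))"
  define M where "M = 2 / r"
  have "norm (laplace F z - (\<Sum>n<N. (deriv ^^ n) (continuation F) 0 * z powi (- int n - 1)))
          \<le> L * M ^ N * fact N * norm z powi (- int N - 1)"
    if "z \<in> halfplane c1" for z N
  proof -
    have z: "Re z > c1" using that by (simp add: halfplane_def)
    then have "Re z > c0" "z \<noteq> 0" using assms by auto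
    let ?I = "CLBINT t:{0..}. exp (- z * of_real t) * g (Suc N) t"
    have exponent: "- 1 - int N = - int N - 1" by simp
    \<comment> \<open>The expansion is taken to order \<open>Suc N\<close>; its last term stays with
      the remainder, so that both carry the power required.\<close>
    have eq: "laplace F z - (\<Sum>n<N. (deriv ^^ n) (continuation F) 0 * z powi (- int n - 1))
        = z powi (- int N - 1) * (g N 0 + ?I)"
      using laplace_expansion[where g = g, OF deriv gbound \<open>Re z > c0\<close> \<open>z \<noteq> 0\<close>, of "Suc N"]
      by (simp add: laplace_def g_def algebra_simps exponent)
    have "norm ?I \<le> fact (Suc N) * B / r ^ Suc N / (Re z - c0)"
      by (rule laplace_integral_bound(2)[OF cont gbound \<open>Re z > c0\<close>])
    also have "\<dots> \<le> fact (Suc N) * B / r ^ Suc N / k"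
      using z \<open>k > 0\<close> \<open>B > 0\<close> r by (intro divide_left_mono mult_pos_pos) (auto simp: k_def)
    finally have "norm (g N 0 + ?I) \<le> fact N * B / r ^ N + fact (Suc N) * B / r ^ Suc N / k"
      using gbound[of 0 N] norm_triangle_ineq[of "g N 0" ?I] by simp
    also have "\<dots> = fact N * B / r ^ N * (1 + real (Suc N) / (r * k))"
      by (simp add: distrib_left mult_ac)
    \<comment> \<open>Both \<open>1\<close> and \<open>Suc N\<close> are at most
      \<open>2 ^ N\<close>.\<close>
    also have "\<dots> \<le> fact N * B / r ^ N * (2 ^ N * (1 + 1 / (r * k)))"
    proof (intro mult_left_mono)
      have "Suc N \<le> 2 ^ N" by (simp add: Suc_leI)
      then have "real (Suc N) \<le> 2 ^ N"
        by (metis of_nat_le_iff of_nat_numeral of_nat_power)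
      then have "real (Suc N) / (r * k) \<le> 2 ^ N / (r * k)"
        using r \<open>k > 0\<close> by (intro divide_right_mono) auto
      from add_mono[OF one_le_power this, of 2 N]
      show "1 + real (Suc N) / (r * k) \<le> 2 ^ N * (1 + 1 / (r * k))"
        by (simp add: distrib_left)
    qed (use \<open>B > 0\<close> r in auto)
    also have "\<dots> = L * M ^ N * fact N"
      by (simp add: L_def M_def power_divide mult_ac)
    finally show ?thesis
      unfolding eq norm_mult norm_power_int
      by (subst mult.commute, intro mult_right_mono) auto
  qed
  moreover have "L > 0" "M > 0"
    using \<open>B > 0\<close> \<open>k > 0\<close> r by (auto simp: L_def M_def intro!: mult_pos_pos add_pos_pos)
  ultimately show ?thesis by blast
qed

end
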